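(* Let $S = \{f_1 < f_2 < \cdots < f_n\}$ be a complete difference tone scale, i.e. a finite set of positive real numbers such that for every pair $x, y \in S$ with $x > y$ there exist $z \in S$ and an integer $t \in \mathbb{Z}$ (depending on $x,y$) with $x - y = 2^t z$. Then $S$ consists solely of rational intervals; that is, there is a positive real number $f$ such that $S \subseteq f\mathbb{Q} = \{ f r : r \in \mathbb{Q}\}$ (so that $x/y \in \mathbb{Q}$ for all $x, y \in S$).
   Context: A frequency is a positive real number. A scale is a finite increasing set of frequencies $S = \{f_1, f_2, \ldots, f_n\}$, $f_1 < f_2 < \cdots < f_n$ (it is not required to span a single octave, i.e. there is no restriction on $f_n/f_1$). A scale $S$ is called a complete difference tone scale if for every pair $x, y \in S$ with $x > y$ there exist $z \in S$ and an integer $t$ (possibly negative or zero) such that $x - y = 2^t z$. An interval of $S$ is a ratio $x/y$ of two elements of $S$, and it is rational if $x/y \in \mathbb{Q}$. *)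

theory Defs
  imports Complex_Main
begin

(* The increasing enumeration f_1 < ... < f_n of a finite set of reals carries no
   information beyond the set itself, so a scale is just a finite set of frequencies.
   The empty set is not excluded. *)
definition scale :: "real set \<Rightarrow> bool" where
  "scale S \<longleftrightarrow> finite S \<and> (\<forall>x\<in>S. x > 0)"

(* The exponent t is an integer, possibly zero or negative, and depends on the pair x, y. *)
definition complete_difference_tone_scale :: "real set \<Rightarrow> bool" where
  "complete_difference_tone_scale S \<longleftrightarrow>
     scale S \<and> (\<forall>x\<in>S. \<forall>y\<in>S. x > y \<longrightarrow> (\<exists>z\<in>S. \<exists>t::int. x - y = 2 powi t * z))"

definition intervals :: "real set \<Rightarrow> real set" where
  "intervals S = {x / y | x y. x \<in> S \<and> y \<in> S}"

end

theory Submission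
  imports Defs
begin

text \<open>
  Let \<open>g\<close> be a \<open>\<rat>\<close>-linear functional on the reals, and let \<open>c\<close> be the maximum of \<open>g x / x\<close>
  over the scale, attained at \<open>x\<close>. Then \<open>h u = g u - c * u\<close> is nonpositive on the scale and
  vanishes at \<open>x\<close>. If \<open>m\<close> is the least frequency and \<open>x - m = 2 powi t * z\<close>, then
  \<open>- h m = 2 powi t * h z \<le> 0\<close>, so \<open>h m = 0\<close>: the maximum is attained at \<open>m\<close>. Applied to \<open>- g\<close>,
  the same argument shows that the minimum is attained at \<open>m\<close> too, so \<open>g x / x\<close> is constant on
  the scale. Two frequencies with irrational ratio are linearly independent over \<open>\<rat>\<close>, and
  would be separated by some \<open>g\<close>.
\<close>

interpretation real_over_rat: vector_space "\<lambda>(q::rat) (x::real). of_rat q * x"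
  by unfold_locales (simp_all add: algebra_simps of_rat_add of_rat_mult)

interpretation real_over_rat_pair: vector_space_pair
  "\<lambda>(q::rat) (x::real). of_rat q * x" "\<lambda>(q::rat) (x::real). of_rat q * x"
  by unfold_locales

abbreviation rat_linear :: "(real \<Rightarrow> real) \<Rightarrow> bool" where
  "rat_linear \<equiv> Vector_Spaces.linear (\<lambda>(q::rat) x. of_rat q * x) (\<lambda>(q::rat) x. of_rat q * x)"

text \<open>\<open>2 powi t\<close> is rational for every integer \<open>t\<close>, negative ones
  included, so it acts as a scalar.\<close>

lemma rat_linear_powi:
  assumes "rat_linear g"
  shows "g (2 powi t * z) = 2 powi t * g z"
proof -
  have "(2::real) powi t = of_rat (2 powi t)"
    by (simp add: power_int_def of_rat_power of_rat_divide)
  then show ?thesis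
    using real_over_rat_pair.linear_scale[OF assms, of "2 powi t" z] by simp
qed

lemma rat_linear_separates_irrational_ratio:
  fixes x y :: real
  assumes "x / y \<notin> \<rat>"
  obtains g where "rat_linear g" "g x = 1" "g y = 0"
proof -
  have "y \<noteq> 0"
    using assms by auto
  have "x \<notin> real_over_rat.span {y}"
  proof
    assume "x \<in> real_over_rat.span {y}"
    then obtain q :: rat where "x = of_rat q * y"
      by (auto simp: real_over_rat.span_singleton)
    then show False
      using assms \<open>y \<noteq> 0\<close> by simp
  qed
  moreover have "x \<noteq> y"
    using assms \<open>y \<noteq> 0\<close> by auto
  ultimately have "\<not> real_over_rat.dependent {x, y}"
    using \<open>y \<noteq> 0\<close> by (simp add: real_over_rat.independent_insert)
  \<comment> \<open>Values on an independent set may be prescribed freely: 1 at \<open>x\<close>, 0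
    at \<open>y\<close>.\<close>
  from real_over_rat_pair.linear_independent_extend[OF this, of "\<lambda>u. if u = x then 1 else 0"]
  show ?thesis
    using that \<open>x \<noteq> y\<close> by auto
qed

lemma rat_linear_ratio_le_Min:
  assumes S: "complete_difference_tone_scale S" and g: "rat_linear g" and "x \<in> S"
  shows "g x / x \<le> g (Min S) / Min S"
proof -
  have fin: "finite S" and pos: "\<And>u. u \<in> S \<Longrightarrow> u > 0"
    using S by (auto simp: complete_difference_tone_scale_def scale_def)
  define m where "m = Min S"
  have m: "m \<in> S" "\<And>u. u \<in> S \<Longrightarrow> m \<le> u"
    unfolding m_def using fin \<open>x \<in> S\<close> by (blast intro: Min_in, simp)
  define c where "c = Max ((\<lambda>u. g u / u) ` S)"
  have "c \<in> (\<lambda>u. g u / u) ` S"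
    unfolding c_def using fin \<open>x \<in> S\<close> by (intro Max_in) auto
  then obtain w where w: "w \<in> S" "g w = c * w"
    using pos by fastforce
  have c_ge: "g u / u \<le> c" if "u \<in> S" for u
    using fin that by (auto simp: c_def)
  then have le: "g u \<le> c * u" if "u \<in> S" for u
    using pos that by (simp add: pos_divide_le_eq)
  have "c * m \<le> g m"
  proof (cases "w = m")
    case True
    then show ?thesis using w by simp
  next
    case False
    then obtain z t where z: "z \<in> S" "w - m = 2 powi t * z"
      using S m w unfolding complete_difference_tone_scale_def
      by (metis order_le_imp_less_or_eq)
    have "c * w - g m = 2 powi t * g z"
      using real_over_rat_pair.linear_diff[OF g, of w m] rat_linear_powi[OF g] w z by simp
    \<comment> \<open>The factor \<open>2 powi t\<close> is positive, so the bound at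
      \<open>z\<close> survives whatever \<open>t\<close> is; the terms \<open>c * w\<close> then
      cancel.\<close>
    also have "\<dots> \<le> 2 powi t * (c * z)"
      using le[OF z(1)] by (intro mult_left_mono) auto
    also have "\<dots> = c * (w - m)"
      using z by simp
    finally show ?thesis
      by (simp add: algebra_simps)
  qed
  then have "c \<le> g m / m"
    using pos[OF m(1)] by (simp add: pos_le_divide_eq)
  then show ?thesis
    using c_ge[OF \<open>x \<in> S\<close>] by (simp add: m_def)
qed

lemma rat_linear_ratio_eq_Min:
  assumes "complete_difference_tone_scale S" and "rat_linear g" and "x \<in> S"
  shows "g x / x = g (Min S) / Min S"
proof -
  have "rat_linear (\<lambda>u. - g u)"
    using assms(2) by (rule real_over_rat_pair.linear_compose_neg)
  then show ?thesis
    using rat_linear_ratio_le_Min[OF assms(1) _ assms(3)] assms(2)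
    by (metis minus_divide_left neg_le_iff_le order_antisym)
qed

lemma ratio_rational:
  assumes S: "complete_difference_tone_scale S" and "x \<in> S" "y \<in> S"
  shows "x / y \<in> \<rat>"
proof (rule ccontr)
  assume "x / y \<notin> \<rat>"
  then obtain g where "rat_linear g" "g x = 1" "g y = 0"
    by (rule rat_linear_separates_irrational_ratio)
  \<comment> \<open>Both sides equal the ratio of \<open>g\<close> at \<open>Min S\<close>.\<close>
  then have "1 / x = 0 / y"
    using rat_linear_ratio_eq_Min[OF S] assms(2,3) by metis
  then show False
    using S \<open>x \<in> S\<close> by (auto simp: complete_difference_tone_scale_def scale_def)
qed

theorem theorem2p1:
  fixes S :: "real set"
  assumes "complete_difference_tone_scale S"
  shows "(\<exists>f::real. f > 0 \<and> S \<subseteq> {f * r | r. r \<in> \<rat>}) \<and> intervals S \<subseteq> \<rat>"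
proof
  show "intervals S \<subseteq> \<rat>"
    using ratio_rational[OF assms] by (auto simp: intervals_def)
  show "\<exists>f::real. f > 0 \<and> S \<subseteq> {f * r | r. r \<in> \<rat>}"
  proof (cases "S = {}")
    case True
    then show ?thesis by (auto intro: exI[of _ 1])
  next
    case False
    \<comment> \<open>Any frequency of the scale can serve as the unit, since all ratios to it are
      rational.\<close>
    then obtain f where "f \<in> S" by auto
    then have "f > 0"
      using assms by (auto simp: complete_difference_tone_scale_def scale_def)
    have "x \<in> {f * r | r. r \<in> \<rat>}" if "x \<in> S" for x
      using ratio_rational[OF assms that \<open>f \<in> S\<close>] \<open>f > 0\<close>
      by (intro CollectI exI[of _ "x / f"]) simp
    then show ?thesis
      using \<open>f > 0\<close> by blast
  qed
qed

end
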